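(* Let $X$ be a real Banach space with $\dim X=3$. Every admissible covering in $X$ is contractible if and only if $X$ is a Hilbert space (i.e. its norm is induced by an inner product).
   Context: Balls are closed balls $B_R(c)$ of radius $R>0$ and center $c$. A covering of a nonempty convex set $V\subset X$ by balls (that is, a family of balls whose union contains $V$) is called admissible if it consists of a finite number of balls, all with the same radius, and all with centers in $V$. A covering of a set by balls is called contractible if the union of these balls is a contractible topological space. *)

theory Defs
  imports "HOL-Analysis.Analysis"
begin

definition admissible_covering :: "'a::real_normed_vector set \<Rightarrow> 'a set set \<Rightarrow> bool" where
  "admissible_covering V \<B> \<longleftrightarrow>
     V \<noteq> {} \<and> convex V \<and> finite \<B> \<and> V \<subseteq> \<Union>\<B> \<and>
     (\<exists>R>0. \<forall>B\<in>\<B>. \<exists>c\<in>V. B = cball c R)"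

definition contractible_covering :: "'a::topological_space set set \<Rightarrow> bool" where
  "contractible_covering \<B> \<longleftrightarrow> contractible (\<Union>\<B>)"

definition inner_product_on_space :: "('a::real_vector \<Rightarrow> 'a \<Rightarrow> real) \<Rightarrow> bool" where
  "inner_product_on_space ip \<longleftrightarrow>
     bilinear ip \<and> (\<forall>x y. ip x y = ip y x) \<and> (\<forall>x. x \<noteq> 0 \<longrightarrow> ip x x > 0)"

(* The library's class real_inner fixes one inner product per type, so whether the given norm
   comes from some inner product is expressed by a predicate on the type. Completeness is not
   repeated here: it is supplied by the class banach. *)
definition hilbert_norm :: "'a::banach itself \<Rightarrow> bool" where
  "hilbert_norm _ \<longleftrightarrow>
     (\<exists>ip :: 'a \<Rightarrow> 'a \<Rightarrow> real. inner_product_on_space ip \<and> (\<forall>x. norm x = sqrt (ip x x)))"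

end

theory Submission
  imports Defs
begin

text \<open>A Hilbert norm makes every admissible covering contractible because nearest-point projection \<open>P\<close>
onto a compact convex set \<open>C\<close> is nonexpansive and fixes \<open>C\<close>: with \<open>C\<close> the closure of \<open>V\<close>, a point
\<open>x\<close> of a ball centred in \<open>V\<close> is no farther from the centre after projection, so the segment from
\<open>x\<close> to \<open>P x\<close> stays inside the ball, and the union retracts by deformation onto \<open>C\<close>
(\<open>contractible_of_centres_in\<close>).

For the converse, fix a linear functional \<open>\<psi>\<close>. Suppose that from the origin one can move in every
direction closer to some unit vector \<open>f\<close> with \<open>\<psi> f > 0\<close>. By compactness finitely many of these \<open>f\<close>
suffice, and the balls of some radius \<open>R < 1\<close> around them miss the origin but cover a
small sphere around it. All of these centres lie in a convex body \<open>\<psi> \<ge> \<epsilon>\<close>, \<open>norm \<le> 2\<close>, which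
can be covered by further \<open>R\<close>-balls whose centres have norm above \<open>R\<close>: pushing a point away from the
origin along its own ray stays in the body. The resulting union surrounds the origin without
containing it, hence is not contractible (\<open>no_contractible_shell\<close>). So contractibility of all
admissible coverings yields a direction \<open>e\<close> along which no distance to such an \<open>f\<close> decreases, and
passing to the limit on the plane \<open>\<psi> = 0\<close>, each vector of the plane is Birkhoff-James orthogonal to \<open>e\<close>
(\<open>exists_common_bj_orthogonal\<close>). In other words, every plane is the range of a projection of norm one.

By a theorem of Kakutani this forces a Hilbert norm; the proof given here goes through reflections.
At a smooth point \<open>u\<close>, with tangent plane direction \<open>H\<close>, all the planes through \<open>u\<close> have their
orthogonal direction in \<open>H\<close>. The curves on which the norm is constant in the slices \<open>\<alpha> u + H\<close>
therefore have the same tangent directions along each ray of \<open>H\<close>, for all \<open>\<alpha>\<close> at once, so they are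
homothetic to the curve for \<open>\<alpha> = 0\<close>. That curve is symmetric about the origin, whence
\<open>N (\<alpha> u + q) = N (\<alpha> u - q)\<close> (\<open>reflection_symmetry_of_slice\<close>): the reflection that negates \<open>u\<close> and
fixes \<open>H\<close> is an isometry. Integrating \<open>(a \<bullet> x) (a \<bullet> y)\<close> over the dual unit ball gives an inner
product invariant under all these reflections, for which they are orthogonal reflections. Smooth points
being dense, all orthogonal reflections are isometries of \<open>N\<close>; they act transitively on the spheres
of the inner product, so \<open>N\<close> is a multiple of the inner product norm (\<open>norm_from_inner_product\<close>).\<close>

section \<open>Coordinates on a three-dimensional space\<close>

lemma coordinates_of_dim_3:
  assumes "dim (UNIV :: 'a::real_normed_vector set) = 3"
  obtains h :: "real^3 \<Rightarrow> 'a::real_normed_vector" and k :: "'a::real_normed_vector \<Rightarrow> real^3"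
  where "bounded_linear h" "bounded_linear k" "\<And>x. k (h x) = x" "\<And>y. h (k y) = y"
proof -
  obtain B :: "'a set" where B: "independent B" "UNIV \<subseteq> span B" "card B = 3"
    using basis_exists[of "UNIV :: 'a set"] assms by metis
  have finB: "finite B"
    using B(3) card.infinite by fastforce
  obtain f :: "3 \<Rightarrow> 'a" where f: "bij_betw f UNIV B"
    using finite_same_card_bij[of "UNIV :: 3 set" B] finB B(3) by auto
  define h where "h x = (\<Sum>i\<in>UNIV. x $ i *\<^sub>R f i)" for x :: "real^3"
  have lin: "linear h"
    by (rule linearI)
       (simp_all add: h_def scaleR_add_left sum.distrib scaleR_sum_right)
  have sum_B: "(\<Sum>b\<in>B. g b *\<^sub>R b) = h (\<chi> i. g (f i))" for g
    unfolding h_def using sum.reindex_bij_betw[OF f, of "\<lambda>b. g b *\<^sub>R b"] by simp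
  have surj: "surj h"
  proof -
    have "y \<in> range h" for y
    proof -
      have "y \<in> span B" using B by auto
      then obtain g where "y = (\<Sum>b\<in>B. g b *\<^sub>R b)"
        using span_finite[OF finB] by auto
      with sum_B show ?thesis by auto
    qed
    then show ?thesis by auto
  qed
  have ker: "x = 0" if "h x = 0" for x
  proof -
    define g where "g b = x $ (inv_into UNIV f b)" for b
    have gf: "g (f i) = x $ i" for i
      using f by (simp add: g_def bij_betw_def)
    then have eq: "(\<chi> i. g (f i)) = x" by (simp add: vec_eq_iff)
    have "(\<Sum>b\<in>B. g b *\<^sub>R b) = 0"
      unfolding sum_B eq using that .
    then have "\<forall>b\<in>B. g b = 0"
      using B(1) finB by (auto simp: dependent_finite)
    moreover have "f i \<in> B" for i using f by (auto simp: bij_betw_def)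
    ultimately show ?thesis using gf by (simp add: vec_eq_iff)
  qed
  have inj: "inj h"
    using ker linear_injective_0[OF lin] by blast
  have bl: "bounded_linear h"
    using lin linear_conv_bounded_linear by blast
  define k where "k = inv h"
  have kh: "k (h x) = x" for x using inj by (simp add: k_def)
  have hk: "h (k y) = y" for y using surj by (simp add: k_def surj_f_inv_f)
  have link: "linear k"
    by (rule linearI; rule injD[OF inj])
       (simp_all add: hk linear_add[OF lin] linear_scale[OF lin])
  \<comment> \<open>On the compact Euclidean sphere \<open>norm (h x)\<close> has a positive minimum, which bounds the inverse.\<close>
  have "compact ((\<lambda>x. norm (h x)) ` sphere 0 1)"
    by (intro compact_continuous_image continuous_intros linear_continuous_on[OF bl]) simp
  moreover have "(axis 1 1 :: real^3) \<in> sphere 0 1" by simp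
  ultimately obtain x0 where x0: "norm x0 = 1"
      "\<And>x. norm x = 1 \<Longrightarrow> norm (h x0) \<le> norm (h x)"
    using compact_attains_inf[of "(\<lambda>x. norm (h x)) ` sphere 0 1"] by fastforce
  define c where "c = norm (h x0)"
  have c: "c > 0" using ker[of x0] x0 by (auto simp: c_def)
  have low: "c * norm x \<le> norm (h x)" for x
  proof (cases "x = 0")
    case False
    have "c \<le> norm (h (x /\<^sub>R norm x))"
      unfolding c_def using x0(2)[of "x /\<^sub>R norm x"] False by simp
    also have "\<dots> = norm (h x) / norm x"
      by (simp add: linear_scale[OF lin] divide_inverse mult.commute)
    finally show ?thesis using False by (simp add: field_simps)
  qed simp
  have "norm (k y) \<le> norm y * (1 / c)" for y
    using low[of "k y"] c by (simp add: hk field_simps)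
  then have "bounded_linear k"
    using link by (meson bounded_linear_axioms.intro bounded_linear.intro)
  with bl kh hk show ?thesis using that by blast
qed

lemma compact_of_closed_bounded_dim_3:
  fixes S :: "'a::real_normed_vector set"
  assumes "dim (UNIV :: 'a set) = 3" "closed S" "bounded S"
  shows "compact S"
proof -
  obtain h :: "real^3 \<Rightarrow> 'a" and k where hk: "bounded_linear h" "bounded_linear k"
      "\<And>x. k (h x) = x" "\<And>y. h (k y) = y"
    using coordinates_of_dim_3[OF assms(1)] by metis
  have "k ` S = h -` S" using hk(3,4) by (auto simp: image_iff) metis
  moreover have "closed (h -` S)"
    using assms(2) by (intro closed_vimage) (auto intro: linear_continuous_on[OF hk(1)])
  moreover have "bounded (k ` S)"
    using assms(3) hk(2) by (rule bounded_linear_image)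
  ultimately have "compact (k ` S)" by (simp add: compact_eq_bounded_closed)
  then have "compact (h ` (k ` S))"
    by (rule compact_continuous_image[OF linear_continuous_on[OF hk(1)]])
  then show ?thesis by (simp add: image_image hk(4))
qed

section \<open>Hilbert norms\<close>

locale inner_product_norm =
  fixes ip :: "'a::real_normed_vector \<Rightarrow> 'a \<Rightarrow> real"
  assumes bil: "bilinear ip"
    and sym: "ip x y = ip y x"
    and norm_ip: "norm x = sqrt (ip x x)"
begin

lemmas ip_simps = bilinear_ladd[OF bil] bilinear_radd[OF bil] bilinear_lsub[OF bil]
  bilinear_rsub[OF bil] bilinear_lmul[OF bil] bilinear_rmul[OF bil] bilinear_lneg[OF bil]
  bilinear_rneg[OF bil]

lemma norm_sq: "(norm x)\<^sup>2 = ip x x"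
proof -
  have "0 \<le> sqrt (ip x x)" using norm_ge_zero[of x] unfolding norm_ip .
  then show ?thesis by (simp add: norm_ip)
qed

lemma norm_sq_diff: "(norm (x - y))\<^sup>2 = (norm x)\<^sup>2 - 2 * ip x y + (norm y)\<^sup>2"
  unfolding norm_sq using sym[of x y] by (simp add: ip_simps)

text \<open>The angle at the nearest point \<open>p\<close> between \<open>x\<close> and any other point of \<open>C\<close> is not acute: otherwise a
short step from \<open>p\<close> towards that point would come closer to \<open>x\<close>.\<close>

lemma nearest_point_obtuse:
  fixes x p c :: 'a
  assumes "convex C" "p \<in> C" "c \<in> C" "\<And>y. y \<in> C \<Longrightarrow> norm (x - p) \<le> norm (x - y)"
  shows "ip (x - p) (c - p) \<le> 0"
proof (rule ccontr)
  define a where "a = ip (x - p) (c - p)"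
  define b where "b = (norm (c - p))\<^sup>2"
  assume "\<not> ?thesis"
  then have a: "a > 0" by (simp add: a_def)
  have le: "2 * a \<le> t * b" if t: "0 < t" "t \<le> 1" for t
  proof -
    have "p + t *\<^sub>R (c - p) = (1 - t) *\<^sub>R p + t *\<^sub>R c" by (simp add: algebra_simps)
    also have "\<dots> \<in> C" using assms(1-3) t by (intro convexD) auto
    finally have "norm (x - p) \<le> norm (x - (p + t *\<^sub>R (c - p)))" by (rule assms(4))
    then have "(norm (x - p))\<^sup>2 \<le> (norm ((x - p) - t *\<^sub>R (c - p)))\<^sup>2"
      by (simp add: power_mono diff_diff_eq)
    also have "\<dots> = (norm (x - p))\<^sup>2 - 2 * t * a + t\<^sup>2 * b"
      unfolding norm_sq_diff[of "x - p"]
      by (simp add: ip_simps(6) a_def b_def power_mult_distrib)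
    finally have "t * (2 * a) \<le> t * (t * b)" by (simp add: power2_eq_square mult_ac)
    then show ?thesis using t by simp
  qed
  have b: "b > 0" using le[of 1] a by simp
  \<comment> \<open>The step \<open>t = a / b\<close> minimises the distance along the line; it is cut off at 1 to stay in \<open>C\<close>.\<close>
  have "2 * a \<le> min 1 (a / b) * b" using a b by (intro le) auto
  also have "\<dots> \<le> a" using b by (simp add: min_def field_simps)
  finally show False using a by simp
qed

lemma nearest_point_nonexpansive:
  fixes x y p q :: 'a
  assumes C: "convex C" "p \<in> C" "q \<in> C"
    and p: "\<And>c. c \<in> C \<Longrightarrow> norm (x - p) \<le> norm (x - c)"
    and q: "\<And>c. c \<in> C \<Longrightarrow> norm (y - q) \<le> norm (y - c)"
  shows "norm (p - q) \<le> norm (x - y)"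
proof -
  have "ip (x - p) (q - p) \<le> 0" "ip (y - q) (p - q) \<le> 0"
    using nearest_point_obtuse[OF C(1) C(2) C(3) p] nearest_point_obtuse[OF C(1) C(3) C(2) q]
    by auto
  \<comment> \<open>Expanding this square takes the place of the Cauchy-Schwarz inequality.\<close>
  moreover have "0 \<le> (norm ((x - y) - (p - q)))\<^sup>2" by simp
  ultimately have "(norm (p - q))\<^sup>2 \<le> (norm (x - y))\<^sup>2"
    unfolding norm_sq_diff[of "x - y"] norm_sq_diff[of "p - q"]
    unfolding norm_sq by (simp add: ip_simps sym[of q p])
  then show ?thesis by (rule power2_le_imp_le) simp
qed

text \<open>A nonexpansive projection \<open>P\<close> onto the closure of \<open>V\<close> moves no point away from any centre, so the
straight-line homotopy from the identity to \<open>P\<close> never leaves the balls; a second straight-line homotopy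
contracts the convex set.\<close>

lemma contractible_of_centres_in:
  fixes V :: "'a set"
  assumes dim: "dim (UNIV :: 'a set) = 3" and adm: "admissible_covering V \<B>"
  shows "contractible (\<Union>\<B>)"
proof -
  obtain R where V: "V \<noteq> {}" "convex V" "finite \<B>" "V \<subseteq> \<Union>\<B>"
      and R: "\<And>B. B \<in> \<B> \<Longrightarrow> \<exists>c\<in>V. B = cball c R"
    using adm unfolding admissible_covering_def by blast
  define C where "C = closure V"
  have clU: "closed (\<Union>\<B>)" using V(3) R by (intro closed_Union) fastforce+
  have bdU: "bounded (\<Union>\<B>)" using V(3) R by (intro bounded_Union) fastforce+
  have CU: "C \<subseteq> \<Union>\<B>" using V(4) clU by (simp add: C_def closure_minimal)
  have C: "convex C" "C \<noteq> {}" using V by (auto simp: C_def convex_closure)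
  have "compact C"
    by (intro compact_of_closed_bounded_dim_3[OF dim] bounded_subset[OF bdU CU]) (simp add: C_def)
  then have "\<exists>p\<in>C. \<forall>c\<in>C. norm (x - p) \<le> norm (x - c)" for x
    using C(2) by (intro continuous_attains_inf continuous_intros)
  then have "\<exists>p. p \<in> C \<and> (\<forall>c\<in>C. norm (x - p) \<le> norm (x - c))" for x
    by blast
  then obtain P where "\<forall>x. P x \<in> C \<and> (\<forall>c\<in>C. norm (x - P x) \<le> norm (x - c))"
    using choice[of "\<lambda>x p. p \<in> C \<and> (\<forall>c\<in>C. norm (x - p) \<le> norm (x - c))"] by blast
  then have P: "\<And>x. P x \<in> C" "\<And>x c. c \<in> C \<Longrightarrow> norm (x - P x) \<le> norm (x - c)"
    by blast+
  have lip: "norm (P x - P y) \<le> norm (x - y)" for x y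
    by (rule nearest_point_nonexpansive[OF C(1) P(1) P(1) P(2) P(2)])
  have fixC: "P c = c" if "c \<in> C" for c
    using P(2)[OF that, of c] by simp
  have contP: "continuous_on S P" for S
    unfolding continuous_on_iff dist_norm using lip by (meson le_less_trans)
  obtain a where a: "a \<in> C" using C(2) by auto
  have "homotopic_with_canon (\<lambda>_. True) (\<Union>\<B>) (\<Union>\<B>) id P"
  proof (rule homotopic_with_linear)
    fix x assume "x \<in> \<Union>\<B>"
    then obtain c where c: "c \<in> V" "x \<in> cball c R" "cball c R \<in> \<B>" using R by blast
    have cC: "c \<in> C" using c(1) closure_subset by (auto simp: C_def)
    have "norm (P x - c) \<le> norm (x - c)" using lip[of x c] fixC[OF cC] by simp
    then have "P x \<in> cball c R" using c(2) by (simp add: dist_norm norm_minus_commute)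
    then have "closed_segment x (P x) \<subseteq> cball c R" using c(2) by (simp add: closed_segment_subset)
    then show "closed_segment (id x) (P x) \<subseteq> \<Union>\<B>" using c(3) by auto
  qed (auto intro: contP)
  moreover have "homotopic_with_canon (\<lambda>_. True) (\<Union>\<B>) (\<Union>\<B>) P (\<lambda>_. a)"
  proof (rule homotopic_with_linear)
    fix x assume "x \<in> \<Union>\<B>"
    show "closed_segment (P x) a \<subseteq> \<Union>\<B>"
      using closed_segment_subset[OF P(1) a C(1)] CU by blast
  qed (auto intro: contP)
  ultimately show ?thesis
    unfolding contractible_def using homotopic_with_trans by blast
qed

end

section \<open>Coverings that enclose a cavity\<close>

text \<open>Radial projection from the origin sends \<open>U\<close> to a sphere, and the small sphere inside \<open>U\<close> goes to it
by a homeomorphism. Contractibility of \<open>U\<close> would thus make the identity of a two-sphere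
null-homotopic.\<close>

lemma no_contractible_shell:
  fixes U :: "'a::real_normed_vector set"
  assumes dim: "dim (UNIV :: 'a set) = 3" and U: "contractible U" "0 \<notin> U"
    and t: "t > 0" "\<And>x. norm x = 1 \<Longrightarrow> t *\<^sub>R x \<in> U"
  shows False
proof -
  obtain h :: "real^3 \<Rightarrow> 'a" and k where hk: "bounded_linear h" "bounded_linear k"
      "\<And>x. k (h x) = x" "\<And>y. h (k y) = y"
    using coordinates_of_dim_3[OF dim] by metis
  interpret h: bounded_linear h by (rule hk(1))
  interpret k: bounded_linear k by (rule hk(2))
  have h0: "h x \<noteq> 0" if "x \<noteq> 0" for x using that hk(3) k.zero by metis
  have k0: "k y \<noteq> 0" if "y \<noteq> 0" for y using that hk(4) h.zero by metis
  define f where "f x = t *\<^sub>R (h x /\<^sub>R norm (h x))" for x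
  define g where "g y = k y /\<^sub>R norm (k y)" for y
  have contf: "continuous_on (sphere 0 1) f"
    unfolding f_def using h0
    by (intro continuous_intros h.continuous_on) (metis norm_eq_zero norm_zero mem_sphere_0 zero_neq_one)
  have fU: "f \<in> sphere 0 1 \<rightarrow> U"
  proof
    fix x :: "real^3" assume "x \<in> sphere 0 1"
    then have "h x \<noteq> 0" by (intro h0) auto
    then show "f x \<in> U" unfolding f_def by (intro t(2)) simp
  qed
  have kU: "k y \<noteq> 0" if "y \<in> U" for y using that U(2) by (intro k0) auto
  have contg: "continuous_on U g"
    unfolding g_def by (intro continuous_intros k.continuous_on) (auto dest: kU)
  have gS: "g \<in> U \<rightarrow> sphere 0 1" using kU by (auto simp: g_def)
  obtain c where c: "homotopic_with_canon (\<lambda>_. True) (sphere 0 1) (sphere 0 1) (g \<circ> f) (\<lambda>_. c)"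
    using nullhomotopic_through_contractible[OF contf fU contg gS U(1)] by blast
  have gf: "(g \<circ> f) x = id x" if "x \<in> sphere 0 1" for x
  proof -
    have "k (f x) = (t / norm (h x)) *\<^sub>R x"
      by (simp add: f_def k.scaleR hk(3) divide_inverse)
    moreover have "x \<noteq> 0" using that by auto
    then have "t / norm (h x) > 0" using t(1) h0 by simp
    ultimately show ?thesis using that t(1) h0[of x] by (auto simp: g_def)
  qed
  have "homotopic_with_canon (\<lambda>_. True) (sphere (0::real^3) 1) (sphere 0 1) id (\<lambda>_. c)"
    by (rule homotopic_with_eq[OF c]) (use gf in auto)
  then have "contractible (sphere (0::real^3) 1)" unfolding contractible_def by blast
  then show False by (simp add: contractible_sphere)
qed

text \<open>If every direction \<open>e\<close> came closer to some unit vector \<open>f e\<close> of the half-space, then \<open>R\<close>-balls around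
finitely many of these vectors, with \<open>R < 1\<close>, would build a shell around the origin, and completing
them to an admissible covering of a body in the half-space would give a union that is not contractible.\<close>

lemma exists_direction_of_no_decrease:
  fixes \<psi> :: "'a::real_normed_vector \<Rightarrow> real"
  assumes dim: "dim (UNIV :: 'a set) = 3" and lin: "bounded_linear \<psi>"
    and contr: "\<forall>(V :: 'a set) \<B>. admissible_covering V \<B> \<longrightarrow> contractible (\<Union>\<B>)"
  shows "\<exists>e. norm e = 1 \<and> (\<forall>f t. \<psi> f > 0 \<longrightarrow> norm f = 1 \<longrightarrow> t > 0 \<longrightarrow> 1 \<le> norm (f - t *\<^sub>R e))"
proof (rule ccontr)
  interpret \<psi>: bounded_linear \<psi> by (rule lin)
  define S where "S = sphere (0::'a) 1"
  assume no: "\<not> ?thesis"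
  have "\<exists>z. \<psi> (fst z) > 0 \<and> norm (fst z) = 1 \<and> snd z > 0 \<and> norm (fst z - snd z *\<^sub>R e) < 1"
    if "e \<in> S" for e
    using no that unfolding S_def by (auto simp: not_le)
  then obtain z where z: "\<And>e. e \<in> S \<Longrightarrow> \<psi> (fst (z e)) > 0 \<and> norm (fst (z e)) = 1 \<and> snd (z e) > 0
      \<and> norm (fst (z e) - snd (z e) *\<^sub>R e) < 1"
    using bchoice[of S "\<lambda>e z. \<psi> (fst z) > 0 \<and> norm (fst z) = 1 \<and> snd z > 0 \<and> norm (fst z - snd z *\<^sub>R e) < 1"]
    by blast
  define f where "f e = fst (z e)" for e
  define T where "T e = snd (z e)" for e
  \<comment> \<open>A bound strictly between the attained distance and 1 leaves room for one common \<open>R < 1\<close> below.\<close>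
  define r where "r e = (1 + norm (f e - T e *\<^sub>R e)) / 2" for e
  have fT: "\<psi> (f e) > 0" "norm (f e) = 1" "T e > 0" "norm (f e - T e *\<^sub>R e) < r e" "r e < 1"
    if "e \<in> S" for e
    using z[OF that] by (auto simp: f_def T_def r_def)
  have "closed S"
    unfolding S_def sphere_def by (intro closed_Collect_eq continuous_intros)
  moreover have "bounded S"
    using bounded_cball[of 0 1] by (rule bounded_subset) (auto simp: S_def)
  ultimately have comS: "compact S" by (rule compact_of_closed_bounded_dim_3[OF dim])
  have op: "open {y. norm (f e - T e *\<^sub>R y) < r e}" for e
    by (intro open_Collect_less continuous_intros)
  have "S \<subseteq> (\<Union>e\<in>S. {y. norm (f e - T e *\<^sub>R y) < r e})" using fT(4) by blast
  then obtain E where E: "E \<subseteq> S" "finite E" "S \<subseteq> (\<Union>e\<in>E. {y. norm (f e - T e *\<^sub>R y) < r e})"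
    by (rule compactE_image[OF comS op])
  obtain h :: "real^3 \<Rightarrow> 'a" and k where hk: "bounded_linear k" "\<And>x. k (h x) = x"
    using coordinates_of_dim_3[OF dim] by metis
  define b where "b = h (axis 1 1)"
  have "b \<noteq> 0"
    using hk(2)[of "axis 1 1"] bounded_linear.linear[OF hk(1), THEN linear_0]
    by (auto simp: b_def axis_eq_0_iff)
  then have "b /\<^sub>R norm b \<in> S" by (simp add: S_def)
  then have Ene: "E \<noteq> {}" using E(3) by auto
  define t where "t = Min (T ` E)"
  have t: "t > 0" "\<And>e. e \<in> E \<Longrightarrow> t \<le> T e"
    using E Ene fT(3) by (auto simp: t_def)
  \<comment> \<open>Convexity of the distance to \<open>f e\<close> along the segment from 0 to \<open>T e *\<^sub>R y\<close> gives this bound at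
    the shorter parameter \<open>t\<close>.\<close>
  define \<rho> where "\<rho> e = 1 - t / T e * (1 - r e)" for e
  have \<rho>: "\<rho> e < 1" if "e \<in> E" for e
    using that E(1) fT[of e] t(1) by (auto simp: \<rho>_def)
  define R where "R = Max (insert (1/2) (\<rho> ` E))"
  have R: "R < 1" "R \<ge> 1/2" "\<And>e. e \<in> E \<Longrightarrow> \<rho> e \<le> R"
    using E(2) \<rho> Max_ge[of "insert (1/2) (\<rho> ` E)" "1/2"] by (auto simp: R_def)
  have shell: "\<exists>e\<in>E. norm (f e - t *\<^sub>R y) \<le> R" if y: "y \<in> S" for y
  proof -
    obtain e where e: "e \<in> E" "norm (f e - T e *\<^sub>R y) < r e" using E(3) y by auto
    have Te: "T e > 0" "norm (f e) = 1" using fT[of e] e(1) E(1) by auto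
    define s where "s = t / T e"
    have s: "0 \<le> s" "s \<le> 1" using t(1) t(2)[OF e(1)] Te by (auto simp: s_def)
    have "f e - t *\<^sub>R y = (1 - s) *\<^sub>R f e + s *\<^sub>R (f e - T e *\<^sub>R y)"
      using Te by (simp add: s_def algebra_simps)
    also have "norm \<dots> \<le> (1 - s) * 1 + s * norm (f e - T e *\<^sub>R y)"
      using norm_triangle_ineq[of "(1 - s) *\<^sub>R f e" "s *\<^sub>R (f e - T e *\<^sub>R y)"] s Te by simp
    also have "\<dots> \<le> (1 - s) * 1 + s * r e"
      using e(2) s by (intro add_left_mono mult_left_mono) auto
    also have "\<dots> = \<rho> e" unfolding \<rho>_def s_def[symmetric] by (simp add: algebra_simps)
    finally show ?thesis using R(3) e(1) by force
  qed
  define \<epsilon> where "\<epsilon> = Min (\<psi> ` f ` E)"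
  have \<epsilon>: "\<epsilon> > 0" "\<And>e. e \<in> E \<Longrightarrow> \<epsilon> \<le> \<psi> (f e)"
    using E Ene fT(1) by (auto simp: \<epsilon>_def)
  define V where "V = {x. \<epsilon> \<le> \<psi> x} \<inter> cball 0 2"
  have "closed {x. \<epsilon> \<le> \<psi> x}"
    by (intro closed_Collect_le continuous_intros \<psi>.continuous_on)
  then have "compact V"
    unfolding V_def by (intro compact_of_closed_bounded_dim_3[OF dim] closed_Int) (auto simp: bounded_Int)
  have fV: "f e \<in> V" if "e \<in> E" for e
    using \<epsilon>(2)[OF that] fT(2)[of e] E(1) that by (auto simp: V_def)
  define D where "D = {c \<in> V. R < norm c}"
  have "V \<subseteq> (\<Union>c\<in>D. ball c R)"
  proof
    fix v assume v: "v \<in> V"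
    show "v \<in> (\<Union>c\<in>D. ball c R)"
    proof (cases "norm v > R")
      case True
      then show ?thesis using v R(2) by (intro UN_I[of v]) (auto simp: D_def)
    next
      case False
      have "v \<noteq> 0" using v \<epsilon>(1) by (auto simp: V_def \<psi>.zero)
      \<comment> \<open>Stretching \<open>v\<close> by the length \<open>R - norm v / 2\<close> keeps it within \<open>R\<close> of \<open>v\<close>, while its norm
        becomes \<open>R + norm v / 2\<close>, above \<open>R\<close> and below 2.\<close>
      define s where "s = (R - norm v / 2) / norm v"
      have s: "s > 0" "s * norm v = R - norm v / 2"
        using \<open>v \<noteq> 0\<close> False R(2) by (auto simp: s_def)
      define c where "c = (1 + s) *\<^sub>R v"
      have normc: "norm c = R + norm v / 2" using s by (simp add: c_def distrib_right)
      have "\<epsilon> \<le> \<psi> v" using v by (simp add: V_def)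
      also have "\<dots> \<le> \<psi> c" using s(1) calculation \<epsilon>(1) by (simp add: c_def \<psi>.scaleR)
      finally have "c \<in> D" using normc R(1) False \<open>v \<noteq> 0\<close> by (simp add: D_def V_def)
      moreover have "v \<in> ball c R"
      proof -
        have "dist c v = norm (s *\<^sub>R v)" by (simp add: c_def dist_norm algebra_simps)
        then show ?thesis using s \<open>v \<noteq> 0\<close> by simp
      qed
      ultimately show ?thesis by blast
    qed
  qed
  then obtain C where C: "C \<subseteq> D" "finite C" "V \<subseteq> (\<Union>c\<in>C. ball c R)"
    by (rule compactE_image[OF \<open>compact V\<close> open_ball])
  define \<B> where "\<B> = (\<lambda>c. cball c R) ` (C \<union> f ` E)"
  have "convex {x. \<epsilon> \<le> \<psi> x}"
    using convex_linear_vimage[OF \<psi>.linear_axioms convex_real_interval(1)[of \<epsilon>]]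
    by (simp add: vimage_def)
  then have "convex V" unfolding V_def by (intro convex_Int convex_cball)
  have "V \<subseteq> (\<Union>c\<in>C. cball c R)" using C(3) ball_subset_cball by blast
  then have cover: "V \<subseteq> \<Union>\<B>" unfolding \<B>_def by blast
  have CV: "C \<union> f ` E \<subseteq> V" using C(1) fV by (auto simp: D_def)
  have "admissible_covering V \<B>"
    unfolding admissible_covering_def
  proof (intro conjI exI[of _ R] ballI)
    show "V \<noteq> {}" using Ene fV by blast
    show "finite \<B>" using C(2) E(2) by (simp add: \<B>_def)
    show "R > 0" using R(2) by simp
    show "\<exists>c\<in>V. B = cball c R" if "B \<in> \<B>" for B using that CV by (auto simp: \<B>_def)
  qed fact+
  then have "contractible (\<Union>\<B>)" using contr by blast
  moreover have "0 \<notin> \<Union>\<B>"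
  proof -
    have "R < norm c" if "c \<in> C \<union> f ` E" for c
      using that C(1) R(1) E(1) fT(2) by (auto simp: D_def)
    then show ?thesis by (fastforce simp: \<B>_def)
  qed
  moreover have "t *\<^sub>R y \<in> \<Union>\<B>" if "norm y = 1" for y
    using shell[of y] that by (auto simp: \<B>_def S_def dist_norm)
  ultimately show False using no_contractible_shell[OF dim _ _ t(1)] by blast
qed

text \<open>The inequality valid for \<open>\<psi> > 0\<close> and positive steps extends to the plane \<open>\<psi> = 0\<close> by continuity;
applying it there to both \<open>f\<close> and \<open>- f\<close> covers steps of either sign. The direction \<open>e\<close> cannot lie in the
plane, since no nonzero vector is orthogonal to itself.\<close>

lemma exists_common_bj_orthogonal:
  fixes \<psi> :: "'a::real_normed_vector \<Rightarrow> real"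
  assumes dim: "dim (UNIV :: 'a set) = 3" and lin: "bounded_linear \<psi>" and "\<psi> g \<noteq> 0"
    and contr: "\<forall>(V :: 'a set) \<B>. admissible_covering V \<B> \<longrightarrow> contractible (\<Union>\<B>)"
  shows "\<exists>e. \<psi> e \<noteq> 0 \<and> (\<forall>f. \<psi> f = 0 \<longrightarrow> (\<forall>t. norm f \<le> norm (f + t *\<^sub>R e)))"
proof -
  interpret \<psi>: bounded_linear \<psi> by (rule lin)
  obtain e where e: "norm e = 1"
      "\<And>f t. \<psi> f > 0 \<Longrightarrow> norm f = 1 \<Longrightarrow> t > 0 \<Longrightarrow> 1 \<le> norm (f - t *\<^sub>R e)"
    using exists_direction_of_no_decrease[OF dim lin contr] by blast
  have half: "norm f \<le> norm (f - t *\<^sub>R e)" if f: "\<psi> f > 0" and t: "t > 0" for f t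
  proof -
    have f0: "f \<noteq> 0" using f \<psi>.zero by auto
    have "1 \<le> norm (f /\<^sub>R norm f - (t / norm f) *\<^sub>R e)"
      using f f0 t by (intro e(2)) (auto simp: \<psi>.scaleR)
    also have "f /\<^sub>R norm f - (t / norm f) *\<^sub>R e = (f - t *\<^sub>R e) /\<^sub>R norm f"
      by (simp add: scaleR_diff_right divide_inverse mult.commute)
    also have "norm \<dots> = norm (f - t *\<^sub>R e) / norm f"
      by (simp add: divide_inverse mult.commute)
    finally show ?thesis using f0 by simp
  qed
  define g' where "g' = \<psi> g *\<^sub>R g"
  have g': "\<psi> g' > 0" using assms(3) by (auto simp: g'_def \<psi>.scaleR zero_less_mult_iff neq_iff)
  have closed_half: "norm f \<le> norm (f - t *\<^sub>R e)" if f: "\<psi> f = 0" and t: "t > 0" for f t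
  proof -
    have "norm (f + inverse (real (Suc n)) *\<^sub>R g') \<le> norm (f + inverse (real (Suc n)) *\<^sub>R g' - t *\<^sub>R e)" for n
      using g' f t by (intro half) (auto simp: \<psi>.add \<psi>.scaleR)
    moreover have "(\<lambda>n. norm (f + inverse (real (Suc n)) *\<^sub>R g')) \<longlonglongrightarrow> norm (f + 0 *\<^sub>R g')"
      by (intro tendsto_intros LIMSEQ_inverse_real_of_nat)
    moreover have "(\<lambda>n. norm (f + inverse (real (Suc n)) *\<^sub>R g' - t *\<^sub>R e)) \<longlonglongrightarrow> norm (f + 0 *\<^sub>R g' - t *\<^sub>R e)"
      by (intro tendsto_intros LIMSEQ_inverse_real_of_nat)
    ultimately show ?thesis using LIMSEQ_le by fastforce
  qed
  have all: "norm f \<le> norm (f + t *\<^sub>R e)" if f: "\<psi> f = 0" for f t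
  proof (cases t "0::real" rule: linorder_cases)
    case less
    then show ?thesis using closed_half[OF f, of "- t"] by simp
  next
    case greater
    have "norm (- f) \<le> norm (- f - t *\<^sub>R e)" using f greater by (intro closed_half) (simp_all add: linear_neg[OF \<psi>.linear])
    then show ?thesis by (metis minus_add_distrib norm_minus_cancel uminus_add_conv_diff diff_conv_add_uminus)
  qed simp
  have "\<psi> e \<noteq> 0"
  proof
    assume "\<psi> e = 0"
    from all[OF this, of "-1"] show False using e(1) by simp
  qed
  with all show ?thesis by blast
qed

section \<open>Norms on Euclidean space and their smooth points\<close>

locale norm_function =
  fixes N :: "'a::euclidean_space \<Rightarrow> real"
  assumes triangle: "N (x + y) \<le> N x + N y"
    and scale: "N (c *\<^sub>R x) = \<bar>c\<bar> * N x"
    and pos: "x \<noteq> 0 \<Longrightarrow> N x > 0"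
begin

lemma zero [simp]: "N 0 = 0" using scale[of 0 0] by simp

lemma nonneg [simp]: "N x \<ge> 0" by (cases "x = 0") (auto intro: less_imp_le pos)

lemma minus [simp]: "N (- x) = N x" using scale[of "-1" x] by simp

lemma minus_commute: "N (x - y) = N (y - x)" using minus[of "x - y"] by simp

lemma reverse_triangle: "N y - N (x - y) \<le> N x"
  using triangle[of x "y - x"] by (simp add: minus_commute)

lemma continuous: "continuous_on S N"
proof -
  have "convex_on UNIV N"
  proof (rule convex_onI)
    fix t x y assume t: "0 < (t::real)" "t < 1"
    show "N ((1 - t) *\<^sub>R x + t *\<^sub>R y) \<le> (1 - t) * N x + t * N y"
      using triangle[of "(1 - t) *\<^sub>R x" "t *\<^sub>R y"] t by (simp add: scale)
  qed simp
  then show ?thesis using convex_on_continuous continuous_on_subset open_UNIV by blast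
qed

lemmas continuous_comp [continuous_intros] = continuous_on_compose2[OF continuous _ subset_UNIV]

lemma isCont_comp: "isCont f a \<Longrightarrow> isCont (\<lambda>x. N (f x)) a"
  using continuous[of UNIV] isCont_o2[of a f N] by (simp add: continuous_on_eq_continuous_at)

lemma lower_bound:
  obtains c where "c > 0" "\<And>x. c * norm x \<le> N x"
proof -
  have "compact (sphere (0::'a) 1)" by simp
  moreover have "sphere (0::'a) 1 \<noteq> {}" by simp
  ultimately obtain x0 where x0: "norm x0 = 1" "\<And>x. norm x = 1 \<Longrightarrow> N x0 \<le> N x"
    using continuous_attains_inf[OF _ _ continuous, of "sphere 0 1"] by auto
  have "N x0 * norm x \<le> N x" for x
  proof (cases "x = 0")
    case False
    have "N x0 \<le> N (x /\<^sub>R norm x)" using x0(2)[of "x /\<^sub>R norm x"] False by simp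
    then show ?thesis using False by (simp add: scale field_simps)
  qed simp
  moreover have "N x0 > 0" using x0(1) by (intro pos) auto
  ultimately show ?thesis using that by blast
qed

text \<open>Birkhoff-James orthogonality. The relation need not be symmetric: it says that the line through \<open>x\<close> in
direction \<open>y\<close> supports the ball centred at the origin that has \<open>x\<close> on its boundary.\<close>

definition bj_orthogonal where "bj_orthogonal x y \<longleftrightarrow> (\<forall>t. N x \<le> N (x + t *\<^sub>R y))"

text \<open>Take a Euclidean ball inside the \<open>N\<close>-ball of \<open>v\<close> around a centre \<open>c\<close> close to \<open>v\<close> and blow it up until it
touches the boundary at \<open>u\<close>. Any line supporting the \<open>N\<close>-ball at \<open>u\<close> supports the Euclidean ball as well,
and so is perpendicular to \<open>u - c\<close>.\<close>

lemma smooth_point_near: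
  assumes "v \<noteq> 0" "\<epsilon> > 0"
  obtains u n where "norm (u - v) < \<epsilon>" "n \<noteq> 0" "\<And>e. bj_orthogonal u e \<Longrightarrow> n \<bullet> e = 0"
proof -
  define \<eta> where "\<eta> = min (1/2) (\<epsilon> / (3 * norm v))"
  have \<eta>: "0 < \<eta>" "\<eta> < 1" "\<eta> * norm v \<le> \<epsilon> / 3"
    using assms by (auto simp: \<eta>_def min_def field_simps)
  define c where "c = (1 - \<eta>) *\<^sub>R v"
  define S where "S = {x. N v \<le> N x}"
  have "closed S" unfolding S_def by (intro closed_Collect_le continuous_intros) 
  moreover have "v \<in> S" by (simp add: S_def)
  ultimately obtain u where u: "u \<in> S" "\<And>y. y \<in> S \<Longrightarrow> dist c u \<le> dist c y"
    using distance_attains_inf[of S c] by blast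
  have vc: "v - c = \<eta> *\<^sub>R v" by (simp add: c_def algebra_simps)
  have "norm (u - v) \<le> norm (u - c) + norm (v - c)"
    using norm_triangle_ineq4[of "u - c" "v - c"] by simp
  also have "\<dots> \<le> 2 * norm (v - c)"
    using u(2)[OF \<open>v \<in> S\<close>] by (simp add: dist_norm norm_minus_commute)
  also have "\<dots> < \<epsilon>" unfolding vc using \<eta> assms by simp
  finally have near: "norm (u - v) < \<epsilon>" .
  have "N c < N v" unfolding c_def scale using \<eta> pos[OF assms(1)] by simp
  then have ne: "u - c \<noteq> 0" using u(1) by (auto simp: S_def)
  have ge: "0 \<le> (u - c) \<bullet> e" if e: "bj_orthogonal u e" for e
  proof (rule ccontr)
    assume neg: "\<not> ?thesis"
    have "u + t *\<^sub>R e \<in> S" for t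
      using e u(1) unfolding bj_orthogonal_def S_def by (auto intro: order_trans)
    then have "norm (u - c) \<le> norm (u - c + t *\<^sub>R e)" for t
      using u(2)[of "u + t *\<^sub>R e"] by (simp add: dist_norm norm_minus_commute algebra_simps)
    then have le: "(u - c) \<bullet> (u - c) \<le> (u - c + t *\<^sub>R e) \<bullet> (u - c + t *\<^sub>R e)" for t
      by (simp add: norm_le)
    define a where "a = (u - c) \<bullet> e"
    have e0: "e \<bullet> e > 0" using neg by auto
    have "0 \<le> 2 * t * a + t\<^sup>2 * (e \<bullet> e)" for t
      using le[of t] by (simp add: inner_add_left inner_add_right inner_commute a_def power2_eq_square)
    from this[of "- a / (e \<bullet> e)"] have "a\<^sup>2 / (e \<bullet> e) \<le> 0"
      using e0 by (simp add: power2_eq_square field_simps)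
    moreover have "a\<^sup>2 / (e \<bullet> e) > 0" using neg e0 by (simp add: a_def)
    ultimately show False by simp
  qed
  have "(u - c) \<bullet> e = 0" if e: "bj_orthogonal u e" for e
  proof -
    have "bj_orthogonal u (- e)"
      using e unfolding bj_orthogonal_def
      by (metis scaleR_minus_left scaleR_minus_right)
    with ge[OF e] ge[of "- e"] show ?thesis by simp
  qed
  with near ne show ?thesis using that by blast
qed

end

section \<open>An inner product invariant under isometries\<close>

context norm_function
begin

definition dual_ball where "dual_ball = {a. \<forall>x. a \<bullet> x \<le> N x}"

text \<open>The moment form of the dual unit ball. It is attached to \<open>N\<close> alone, so every linear isometry of \<open>N\<close>
preserves it.\<close>

definition dual_form where "dual_form x y = integral dual_ball (\<lambda>a. (a \<bullet> x) * (a \<bullet> y))"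

lemma compact_dual_ball: "compact dual_ball"
proof -
  have "dual_ball = (\<Inter>x. {a. x \<bullet> a \<le> N x})"
    by (auto simp: dual_ball_def inner_commute)
  then have cl: "closed dual_ball"
    by (auto intro: closed_halfspace_le)
  have "\<bar>a \<bullet> b\<bar> \<le> N b" if "a \<in> dual_ball" for a b
    using that[unfolded dual_ball_def] minus[of b]
    by (metis abs_le_iff inner_minus_right mem_Collect_eq)
  then have "norm a \<le> (\<Sum>b\<in>Basis. N b)" if "a \<in> dual_ball" for a
    using that norm_le_l1[of a] by (meson order_trans sum_mono)
  then have "bounded dual_ball" unfolding bounded_iff by blast
  with cl show ?thesis by (simp add: compact_eq_bounded_closed)
qed

lemma dual_form_abs_integrable:
  "(\<lambda>a. (a \<bullet> x) * (a \<bullet> y)) absolutely_integrable_on dual_ball"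
proof -
  let ?f = "\<lambda>a. indicator dual_ball a *\<^sub>R ((a \<bullet> x) * (a \<bullet> y))"
  have "integrable lborel ?f"
    by (intro borel_integrable_compact compact_dual_ball continuous_intros)
  then have "integrable (completion lborel) ?f"
    using integrable_completion borel_measurable_integrable by blast
  then show ?thesis by (simp add: set_integrable_def)
qed

lemma dual_form_integrable: "(\<lambda>a. (a \<bullet> x) * (a \<bullet> y)) integrable_on dual_ball"
  using dual_form_abs_integrable by (rule set_lebesgue_integral_eq_integral(1))

lemma dual_form_sym: "dual_form x y = dual_form y x"
  by (simp add: dual_form_def mult.commute)

lemma dual_form_bilinear: "bilinear dual_form"
proof -
  have "linear (dual_form x)" for x
    by (rule linearI)
       (simp_all add: dual_form_def inner_add_right distrib_left integral_add dual_form_integrable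
         mult.left_commute)
  then show ?thesis unfolding bilinear_def using dual_form_sym by simp
qed

text \<open>The dual ball contains a box around the origin, on which \<open>(a \<bullet> x)\<^sup>2\<close> is continuous and not
identically zero.\<close>

lemma dual_form_pos:
  assumes "x \<noteq> 0"
  shows "dual_form x x > 0"
proof -
  obtain c where c: "c > 0" "\<And>y. c * norm y \<le> N y" using lower_bound by blast
  have sub: "cball 0 c \<subseteq> dual_ball"
  proof
    fix a :: 'a assume a: "a \<in> cball 0 c"
    have "a \<bullet> y \<le> N y" for y
      using norm_cauchy_schwarz[of a y] mult_right_mono[of "norm a" c "norm y"] c(2)[of y] a by simp
    then show "a \<in> dual_ball" by (simp add: dual_ball_def)
  qed
  have "open (ball (0::'a) c)" "(0::'a) \<in> ball 0 c" using c by auto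
  then obtain l r :: 'a where lr: "0 \<in> box l r" "cbox l r \<subseteq> ball 0 c"
    by (rule open_contains_cbox)
  let ?f = "\<lambda>a. (a \<bullet> x) * (a \<bullet> x)"
  have int: "?f integrable_on cbox l r" by (intro integrable_continuous continuous_intros)
  have "integral (cbox l r) ?f \<le> dual_form x x"
    unfolding dual_form_def using order_trans[OF order_trans[OF lr(2) ball_subset_cball] sub]
    by (intro integral_subset_le int dual_form_integrable) auto
  moreover have "integral (cbox l r) ?f \<noteq> 0"
  proof
    assume "integral (cbox l r) ?f = 0"
    then have zero: "(?f has_integral 0) (cbox l r)" using integrable_integral[OF int] by simp
    have "isCont (\<lambda>t. t *\<^sub>R x) (0::real)" by (intro continuous_intros)
    then have "((\<lambda>t. t *\<^sub>R x) \<longlongrightarrow> 0) (at (0::real))" by (simp add: isCont_def)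
    then have "\<forall>\<^sub>F t in at (0::real). t *\<^sub>R x \<in> box l r"
      using lr(1) by (rule topological_tendstoD[OF _ open_box])
    then have "\<forall>\<^sub>F t in at (0::real). t *\<^sub>R x \<in> box l r \<and> t \<noteq> 0"
      by (intro eventually_conj) (auto simp: eventually_at_filter)
    then obtain t :: real where t: "t *\<^sub>R x \<in> box l r" "t \<noteq> 0"
      using eventually_happens'[OF at_neq_bot] by blast
    have "?f (t *\<^sub>R x) = 0"
    proof (rule has_integral_0_cbox_imp_0[OF _ _ zero])
      show "continuous_on (cbox l r) ?f" by (intro continuous_intros)
      show "box l r \<noteq> {}" using t(1) by auto
      show "t *\<^sub>R x \<in> cbox l r" using t(1) box_subset_cbox by blast
    qed simp
    with t(2) assms show False by simp
  qed
  moreover have "integral (cbox l r) ?f \<ge> 0" by (intro integral_nonneg int) simp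
  ultimately show ?thesis by linarith
qed

end

locale norm_function_3 = norm_function N for N :: "real^3 \<Rightarrow> real"
begin

text \<open>The adjoint of an isometry maps the dual ball onto itself, and as an involution it has determinant of
absolute value 1, so the change of variables leaves the integral as it is.\<close>

lemma dual_form_invariant:
  fixes x y :: "real^3"
  assumes lin: "linear \<sigma>" and iso: "\<And>x. N (\<sigma> x) = N x" and inv: "\<And>x. \<sigma> (\<sigma> x) = x"
  shows "dual_form (\<sigma> x) (\<sigma> y) = dual_form x y"
proof -
  define \<tau> where "\<tau> = adjoint \<sigma>"
  have lin\<tau>: "linear \<tau>" unfolding \<tau>_def by (rule adjoint_linear[OF lin])
  have adj: "\<tau> a \<bullet> z = a \<bullet> \<sigma> z" for a z unfolding \<tau>_def by (rule adjoint_clauses(2)[OF lin])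
  have inv\<tau>: "\<tau> (\<tau> a) = a" for a
  proof -
    have "\<tau> (\<tau> a) \<bullet> z = a \<bullet> z" for z by (simp add: adj inv)
    then show ?thesis by (metis inner_eq_zero_iff inner_diff_left eq_iff_diff_eq_0)
  qed
  have "\<tau> a \<in> dual_ball" if "a \<in> dual_ball" for a
    using that unfolding dual_ball_def by (auto simp: adj) (metis iso)
  then have img: "\<tau> ` dual_ball = dual_ball"
    using inv\<tau> by (metis image_subsetI subset_antisym subsetI image_eqI)
  have "matrix \<tau> ** matrix \<tau> = matrix (\<tau> \<circ> \<tau>)"
    using matrix_compose[OF lin\<tau> lin\<tau>] by simp
  also have "\<tau> \<circ> \<tau> = id" by (simp add: fun_eq_iff inv\<tau>)
  finally have "det (matrix \<tau>) * det (matrix \<tau>) = 1"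
    by (metis det_mul det_I matrix_id_mat_1)
  then have det: "\<bar>det (matrix \<tau>)\<bar> = 1"
    by (metis abs_mult_self_eq abs_mult abs_1 real_sqrt_abs2 real_sqrt_one)
  let ?f = "\<lambda>a. (a \<bullet> x) * (a \<bullet> y)"
  have "integral (\<tau> ` dual_ball) (\<lambda>a. vec (?f a) :: real^1) =
      integral dual_ball ((\<lambda>a. vec (?f a) :: real^1) \<circ> \<tau>)"
    using integral_change_of_variables_linear[OF lin\<tau>, where f = "\<lambda>a. vec (?f a) :: real^1" and S = dual_ball]
    by (simp add: det img absolutely_integrable_on_1_iff dual_form_abs_integrable)
  then have "integral dual_ball ?f = integral dual_ball (\<lambda>a. ?f (\<tau> a))"
    unfolding integral_on_1_eq img by (simp add: vec_eq_iff o_def)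
  then show ?thesis unfolding dual_form_def by (simp add: adj)
qed

end

section \<open>Norm-one projections onto planes give isometric reflections\<close>

text \<open>Over a partition of \<open>[a, b]\<close> into \<open>n\<close> equal parts the bounds telescope to
\<open>K * (m b - m a) * (b - a) / n\<close>, which tends to 0. The function \<open>m\<close> may jump, as
subgradients do, so slices of a norm can be compared where it is not differentiable.\<close>

lemma eq_of_monotone_controlled_increments:
  fixes F m :: "real \<Rightarrow> real"
  assumes "\<And>s t. s \<le> t \<Longrightarrow> \<bar>F t - F s\<bar> \<le> K * (m t - m s) * (t - s)"
  shows "F a = F b"
proof -
  have main: "F a = F b" if "a \<le> b" for a b
  proof -
    define M where "M = K * (m b - m a) * (b - a)"
    have bound: "\<bar>F b - F a\<bar> \<le> M / real (Suc n)" for n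
    proof -
      define x where "x i = a + real i * ((b - a) / real (Suc n))" for i
      have x0: "x 0 = a" and xn: "x (Suc n) = b" by (simp_all add: x_def)
      have step: "x (Suc i) - x i = (b - a) / real (Suc n)" for i
        unfolding x_def of_nat_Suc[of i] by (simp only: distrib_right)
      have mono: "x i \<le> x (Suc i)" for i
      proof -
        have "0 \<le> (b - a) / real (Suc n)" using that by simp
        then show ?thesis using step[of i] by linarith
      qed
      have "\<bar>F b - F a\<bar> = \<bar>\<Sum>i<Suc n. F (x (Suc i)) - F (x i)\<bar>"
        using sum_lessThan_telescope[of "\<lambda>i. F (x i)" "Suc n"] by (simp only: x0 xn)
      also have "\<dots> \<le> (\<Sum>i<Suc n. \<bar>F (x (Suc i)) - F (x i)\<bar>)" by (rule sum_abs)
      also have "\<dots> \<le> (\<Sum>i<Suc n. (m (x (Suc i)) - m (x i)) * (K * ((b - a) / real (Suc n))))"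
      proof (rule sum_mono)
        fix i
        show "\<bar>F (x (Suc i)) - F (x i)\<bar> \<le> (m (x (Suc i)) - m (x i)) * (K * ((b - a) / real (Suc n)))"
          using assms[OF mono[of i]] unfolding step by (simp add: mult_ac)
      qed
      also have "\<dots> = (m b - m a) * (K * ((b - a) / real (Suc n)))"
        using sum_lessThan_telescope[of "\<lambda>i. m (x i)" "Suc n"]
        by (simp only: sum_distrib_right[symmetric] x0 xn)
      finally show ?thesis by (simp add: M_def mult_ac)
    qed
    have "(\<lambda>n. M / real (Suc n)) \<longlonglongrightarrow> 0"
      using tendsto_mult_right_zero[OF LIMSEQ_inverse_real_of_nat, of M] by (simp add: divide_inverse)
    then have "\<bar>F b - F a\<bar> \<le> 0"
      using bound by (intro tendsto_lowerbound[of _ 0 sequentially]) auto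
    then show ?thesis by simp
  qed
  show ?thesis
    using main[of a b] main[of b a, symmetric] linear[of a b] by blast
qed

unbundle cross3_syntax

text \<open>The assumption \<open>plane\<close> states that each plane through the origin is the range of a linear projection
of norm one, with kernel spanned by \<open>e\<close>.\<close>

locale plane_orthogonal_norm = norm_function_3 N for N :: "real^3 \<Rightarrow> real" +
  assumes plane: "n \<noteq> 0 \<Longrightarrow> \<exists>e. n \<bullet> e \<noteq> 0 \<and> (\<forall>f. n \<bullet> f = 0 \<longrightarrow> bj_orthogonal f e)"
begin

lemma normal_not_orthogonal:
  assumes n: "n \<noteq> 0" and smooth: "\<And>e. bj_orthogonal u e \<Longrightarrow> n \<bullet> e = 0"
  shows "n \<bullet> u \<noteq> 0"
  using plane[OF n] smooth by blast

text \<open>In the plane spanned by \<open>u\<close> and \<open>h\<close> all vectors are orthogonal to one common vector \<open>e\<close>. Smoothness at \<open>u\<close>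
puts \<open>e\<close> into the tangent direction \<open>n \<bullet> e = 0\<close>, which is spanned by \<open>h\<close> and \<open>q\<close>; so \<open>e\<close> is a multiple
of some \<open>q - x *\<^sub>R h\<close>. The point is that \<open>x\<close> does not depend on \<open>\<alpha>\<close> and \<open>\<beta>\<close>.\<close>

lemma common_direction:
  assumes n: "n \<noteq> 0" and smooth: "\<And>e. bj_orthogonal u e \<Longrightarrow> n \<bullet> e = 0"
    and h: "n \<bullet> h = 0" and q: "n \<bullet> q = 0" and indep: "(u \<times> h) \<bullet> q \<noteq> 0"
  shows "\<exists>x. \<forall>\<alpha> \<beta>. bj_orthogonal (\<alpha> *\<^sub>R u + \<beta> *\<^sub>R h) (q - x *\<^sub>R h)"
proof -
  define m where "m = u \<times> h"
  have "m \<noteq> 0" using indep by (auto simp: m_def)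
  then obtain e where e: "m \<bullet> e \<noteq> 0" "\<And>f. m \<bullet> f = 0 \<Longrightarrow> bj_orthogonal f e"
    using plane by blast
  have mu: "m \<bullet> u = 0" and mh: "m \<bullet> h = 0"
    by (simp_all add: m_def dot_cross_self inner_commute)
  have ne: "n \<bullet> e = 0" using smooth e(2)[OF mu] .
  define s where "s = (m \<bullet> q) / (m \<bullet> e)"
  define z where "z = q - s *\<^sub>R e"
  have mz: "m \<bullet> z = 0" using e(1) by (simp add: z_def s_def inner_diff_right)
  have nz: "n \<bullet> z = 0" using ne q by (simp add: z_def inner_diff_right)
  define w where "w = z \<times> h"
  have "u \<bullet> w = 0"
    using mz cross_triple[of u h z]
    by (simp add: w_def m_def cross_skew[of z h] inner_commute[of u])
  moreover have "n \<times> w = 0" unfolding w_def Lagrange using nz h by simp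
  ultimately have "(n \<bullet> u) *\<^sub>R w = 0"
    using Lagrange[of u n w] by (simp add: inner_commute)
  then have "w = 0" using normal_not_orthogonal[OF n smooth] by simp
  then have "h \<times> (z \<times> h) = 0" by (simp add: w_def)
  then have "(h \<bullet> h) *\<^sub>R z = (h \<bullet> z) *\<^sub>R h" unfolding Lagrange by simp
  moreover have "h \<noteq> 0" using indep by auto
  ultimately have z: "z = ((h \<bullet> z) / (h \<bullet> h)) *\<^sub>R h"
    by (metis divide_inverse_commute inner_eq_zero_iff scaleR_left.zero scaleR_scaleR left_inverse scaleR_one)
  have "q - ((h \<bullet> z) / (h \<bullet> h)) *\<^sub>R h = s *\<^sub>R e"
    unfolding z[symmetric] by (simp add: z_def)
  moreover have "bj_orthogonal (\<alpha> *\<^sub>R u + \<beta> *\<^sub>R h) (s *\<^sub>R e)" for \<alpha> \<beta>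
  proof -
    have "bj_orthogonal (\<alpha> *\<^sub>R u + \<beta> *\<^sub>R h) e"
      using mu mh by (intro e(2)) (simp add: inner_add_right)
    then show ?thesis unfolding bj_orthogonal_def by simp
  qed
  ultimately show ?thesis by metis
qed

text \<open>In the plane \<open>n \<bullet> h = 0\<close>, let \<open>h \<tau> = p + \<tau> *\<^sub>R q\<close> run along a line parallel to \<open>q\<close>, and let \<open>\<nu> \<tau>\<close> be its
norm. The direction common to all slices at \<open>h \<tau>\<close> determines a subgradient \<open>m \<tau>\<close> of the convex function
\<open>\<nu>\<close>. Moving along that direction decreases the norm in no slice, so
\<open>F \<tau> = N (a *\<^sub>R u + h \<tau> /\<^sub>R \<nu> \<tau>)\<close> changes between \<open>s\<close> and \<open>t\<close> by at most a constant multiple of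
the error of the subgradient inequality for \<open>\<nu>\<close>, hence of \<open>(m t - m s) * (t - s)\<close>: \<open>F\<close> is constant. As \<open>\<tau>\<close> tends to plus or minus
infinity, \<open>h \<tau> /\<^sub>R \<nu> \<tau>\<close> tends to the \<open>N\<close>-unit vector of \<open>q\<close> or of \<open>- q\<close>.\<close>

lemma reflection_symmetry_of_slice:
  assumes n: "n \<noteq> 0" and smooth: "\<And>e. bj_orthogonal u e \<Longrightarrow> n \<bullet> e = 0"
    and q: "n \<bullet> q = 0"
  shows "N (\<alpha> *\<^sub>R u + q) = N (\<alpha> *\<^sub>R u - q)"
proof (cases "q = 0")
  case False
  define p where "p = n \<times> q"
  define h where "h \<tau> = p + \<tau> *\<^sub>R q" for \<tau>
  have pq: "p \<bullet> q = 0" and np: "n \<bullet> p = 0" by (simp_all add: p_def dot_cross_self)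
  have p0: "p \<noteq> 0" using norm_and_cross_eq_0[of n q] n False q by (auto simp: p_def)
  have nh: "n \<bullet> h \<tau> = 0" for \<tau> using np q by (simp add: h_def inner_add_right)
  have indep: "(u \<times> h \<tau>) \<bullet> q \<noteq> 0" for \<tau>
  proof -
    \<comment> \<open>The triple product is \<open>u \<bullet> (p \<times> q)\<close>, and \<open>p \<times> q\<close> is a nonzero multiple of \<open>n\<close>.\<close>
    have "p \<times> q = - ((q \<bullet> q) *\<^sub>R n)"
      unfolding p_def cross_skew[of "n \<times> q" q] Lagrange using q by (simp add: inner_commute)
    moreover have "(u \<times> h \<tau>) \<bullet> q = u \<bullet> (p \<times> q)"
      by (simp add: h_def cross_add_right cross_mult_right inner_add_left dot_cross_self
          cross_triple[of u p q] inner_commute[of u])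
    ultimately show ?thesis
      using normal_not_orthogonal[of n u, OF n smooth] False by (simp add: inner_commute[of u])
  qed
  have "\<forall>\<tau>. \<exists>x. \<forall>\<alpha> \<beta>. bj_orthogonal (\<alpha> *\<^sub>R u + \<beta> *\<^sub>R h \<tau>) (q - x *\<^sub>R h \<tau>)"
    using common_direction[OF n smooth nh q indep] by blast
  then obtain x where
    x: "\<And>\<tau> \<alpha> \<beta>. bj_orthogonal (\<alpha> *\<^sub>R u + \<beta> *\<^sub>R h \<tau>) (q - x \<tau> *\<^sub>R h \<tau>)"
    using choice[of "\<lambda>\<tau> x. \<forall>\<alpha> \<beta>. bj_orthogonal (\<alpha> *\<^sub>R u + \<beta> *\<^sub>R h \<tau>) (q - x *\<^sub>R h \<tau>)"] by blast
  define \<nu> where "\<nu> \<tau> = N (h \<tau>)" for \<tau>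
  define m where "m \<tau> = x \<tau> * \<nu> \<tau>" for \<tau>
  have move: "h t = (1 + (t - s) * x s) *\<^sub>R h s + (t - s) *\<^sub>R (q - x s *\<^sub>R h s)" for s t
    by (simp add: h_def algebra_simps)
  have ge: "N (a *\<^sub>R u + (b * (1 + (t - s) * x s)) *\<^sub>R h s) \<le> N (a *\<^sub>R u + b *\<^sub>R h t)" for a b s t
  proof -
    have "b *\<^sub>R h t = (b * (1 + (t - s) * x s)) *\<^sub>R h s + (b * (t - s)) *\<^sub>R (q - x s *\<^sub>R h s)"
      by (subst move[of t s]) (simp only: scaleR_add_right scaleR_scaleR)
    then show ?thesis
      using x[of a "b * (1 + (t - s) * x s)" s] unfolding bj_orthogonal_def
      by (simp add: add.assoc)
  qed
  have subgrad: "\<nu> s + (t - s) * m s \<le> \<nu> t" for s t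
  proof -
    have "\<nu> s + (t - s) * m s \<le> \<bar>1 + (t - s) * x s\<bar> * \<nu> s"
      using mult_right_mono[OF abs_ge_self, of "\<nu> s" "1 + (t - s) * x s"]
      by (simp add: m_def \<nu>_def algebra_simps)
    also have "\<dots> \<le> \<nu> t"
      using ge[of 0 1 t s] by (simp add: scale \<nu>_def)
    finally show ?thesis .
  qed
  \<comment> \<open>Since \<open>p\<close> is Euclidean-perpendicular to \<open>q\<close>, the line \<open>h\<close> stays away from the origin.\<close>
  obtain c where c: "c > 0" "\<And>y. c * norm y \<le> N y" using lower_bound by blast
  define \<kappa> where "\<kappa> = c * norm p"
  have \<kappa>: "\<kappa> > 0" using c(1) p0 by (simp add: \<kappa>_def)
  have low: "\<kappa> \<le> \<nu> \<tau>" for \<tau>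
  proof -
    have "0 \<le> \<tau> * \<tau> * (q \<bullet> q)" by (rule mult_nonneg_nonneg[OF zero_le_square inner_ge_zero])
    then have "norm p \<le> norm (h \<tau>)"
      unfolding norm_le h_def using pq
      by (simp add: inner_add_left inner_add_right inner_commute mult.assoc)
    then have "\<kappa> \<le> c * norm (h \<tau>)" using c(1) by (simp add: \<kappa>_def)
    also have "\<dots> \<le> \<nu> \<tau>" unfolding \<nu>_def by (rule c(2))
    finally show ?thesis .
  qed
  have const: "N (a *\<^sub>R u + (1 / \<nu> s) *\<^sub>R h s) = N (a *\<^sub>R u + (1 / \<nu> t) *\<^sub>R h t)" for a s t
  proof -
    define F where "F s = N (a *\<^sub>R u + (1 / \<nu> s) *\<^sub>R h s)" for s
    have drop: "F s - (\<nu> t - \<nu> s - (t - s) * m s) / \<nu> t \<le> F t" for s t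
    proof -
      define b where "b = 1 / \<nu> t * (1 + (t - s) * x s)"
      have \<nu>: "\<nu> s > 0" "\<nu> t > 0" using low[of s] low[of t] \<kappa> by auto
      have "N ((a *\<^sub>R u + b *\<^sub>R h s) - (a *\<^sub>R u + (1 / \<nu> s) *\<^sub>R h s)) = \<bar>b - 1 / \<nu> s\<bar> * \<nu> s"
        by (simp add: \<nu>_def scale flip: scaleR_left_diff_distrib)
      also have "\<dots> = \<bar>(b - 1 / \<nu> s) * \<nu> s\<bar>" using \<nu> by (simp add: abs_mult)
      also have "(b - 1 / \<nu> s) * \<nu> s = - ((\<nu> t - \<nu> s - (t - s) * m s) / \<nu> t)"
        using \<nu> by (simp add: b_def m_def field_simps)
      also have "\<bar>\<dots>\<bar> = (\<nu> t - \<nu> s - (t - s) * m s) / \<nu> t"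
        using \<nu> subgrad[of s t] by simp
      finally have "F s - (\<nu> t - \<nu> s - (t - s) * m s) / \<nu> t \<le> N (a *\<^sub>R u + b *\<^sub>R h s)"
        unfolding F_def using reverse_triangle[of "a *\<^sub>R u + (1 / \<nu> s) *\<^sub>R h s" "a *\<^sub>R u + b *\<^sub>R h s"] by simp
      also have "\<dots> \<le> F t" unfolding F_def b_def by (rule ge)
      finally show ?thesis .
    qed
    have drop': "F s - (1 / \<kappa>) * (m t - m s) * (t - s) \<le> F t" for s t
    proof -
      have "(\<nu> t - \<nu> s - (t - s) * m s) / \<nu> t \<le> (\<nu> t - \<nu> s - (t - s) * m s) / \<kappa>"
        using subgrad[of s t] low[of t] \<kappa> by (intro divide_left_mono) auto
      also have "\<dots> \<le> ((m t - m s) * (t - s)) / \<kappa>"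
        using subgrad[of t s] \<kappa> by (intro divide_right_mono) (auto simp: algebra_simps)
      finally show ?thesis using drop[of s t] by simp
    qed
    have "\<bar>F t - F s\<bar> \<le> (1 / \<kappa>) * (m t - m s) * (t - s)" for s t
    proof -
      have "(1 / \<kappa>) * (m s - m t) * (s - t) = (1 / \<kappa>) * (m t - m s) * (t - s)"
        by (simp only: mult.assoc minus_diff_eq[of "m t" "m s", symmetric]
            minus_diff_eq[of t s, symmetric] minus_mult_minus)
      then show ?thesis using drop'[of s t] drop'[of t s] by linarith
    qed
    then have "F s = F t" by (rule eq_of_monotone_controlled_increments)
    then show ?thesis by (simp add: F_def)
  qed
  have unit: "N (a *\<^sub>R u + (1 / N q) *\<^sub>R q) = N (a *\<^sub>R u - (1 / N q) *\<^sub>R q)" for a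
  proof -
    \<comment> \<open>Homogeneity turns \<open>\<tau> = r / s\<close> with \<open>r = 1\<close> or \<open>r = -1\<close> into a limit at \<open>s = 0\<close>, where the
      expression is continuous.\<close>
    define G where "G r s = N (a *\<^sub>R u + (1 / N (s *\<^sub>R p + r *\<^sub>R q)) *\<^sub>R (s *\<^sub>R p + r *\<^sub>R q))" for r s
    have lim: "(G r \<longlongrightarrow> G r 0) (at_right 0)" if "r \<noteq> 0" for r
    proof -
      have "isCont (G r) 0"
        unfolding G_def using that False pos[OF False]
        by (intro continuous_intros isCont_comp)
           (auto simp: scale)
      then show ?thesis unfolding isCont_def by (rule tendsto_within_subset) simp
    qed
    have G: "G r s = N (a *\<^sub>R u + (1 / \<nu> (r / s)) *\<^sub>R h (r / s))" if "s > 0" for r s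
    proof -
      have "s *\<^sub>R p + r *\<^sub>R q = s *\<^sub>R h (r / s)" using that by (simp add: h_def scaleR_add_right)
      then show ?thesis using that by (simp add: G_def scale \<nu>_def)
    qed
    have "G 1 s = G (-1) s" if "s > 0" for s
      using G[OF that, of 1] G[OF that, of "-1"] const[of a "1 / s" "-1 / s"] by simp
    then have "\<forall>\<^sub>F s in at_right 0. G 1 s = G (-1) s"
      using eventually_at_right_less[of "0::real"] by (rule eventually_mono[rotated])
    then have "(G (-1) \<longlongrightarrow> G 1 0) (at_right 0)"
      using lim[of 1] by (auto elim: Lim_transform_eventually)
    then have "G 1 0 = G (-1) 0"
      using lim[of "-1"] by (intro tendsto_unique[of "at_right (0::real)" "G (-1)"]) auto
    then show ?thesis by (simp add: G_def)
  qed
  have "N q > 0" using pos False by simp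
  then have "\<alpha> *\<^sub>R u + q = N q *\<^sub>R ((\<alpha> / N q) *\<^sub>R u + (1 / N q) *\<^sub>R q)"
    "\<alpha> *\<^sub>R u - q = N q *\<^sub>R ((\<alpha> / N q) *\<^sub>R u - (1 / N q) *\<^sub>R q)"
    by (simp_all add: scaleR_add_right scaleR_diff_right)
  then show ?thesis by (simp only: scale unit)
qed simp

section \<open>Isometric reflections give an inner product\<close>

lemma dual_form_zero [simp]: "dual_form x 0 = 0" "dual_form 0 x = 0"
  using bilinear_rzero[OF dual_form_bilinear] bilinear_lzero[OF dual_form_bilinear] by auto

lemmas dual_form_simps = bilinear_ladd[OF dual_form_bilinear] bilinear_radd[OF dual_form_bilinear]
  bilinear_lsub[OF dual_form_bilinear] bilinear_rsub[OF dual_form_bilinear]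
  bilinear_lmul[OF dual_form_bilinear] bilinear_rmul[OF dual_form_bilinear]
  bilinear_lneg[OF dual_form_bilinear] bilinear_rneg[OF dual_form_bilinear]

definition reflect where "reflect u x = x - (2 * dual_form x u / dual_form u u) *\<^sub>R u"

text \<open>The reflection \<open>\<sigma>\<close> that negates \<open>u\<close> and fixes the tangent direction is an isometry by the symmetry of
slices. Invariance of the form under \<open>\<sigma>\<close> makes the tangent direction orthogonal to \<open>u\<close> for the form, so
\<open>\<sigma>\<close> is the orthogonal reflection.\<close>

lemma norm_reflect_at_smooth:
  assumes n: "n \<noteq> 0" and smooth: "\<And>e. bj_orthogonal u e \<Longrightarrow> n \<bullet> e = 0"
  shows "N (reflect u x) = N x"
proof -
  have nu: "n \<bullet> u \<noteq> 0" by (rule normal_not_orthogonal[OF n smooth])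
  define \<sigma> where "\<sigma> x = x - (2 * (n \<bullet> x) / (n \<bullet> u)) *\<^sub>R u" for x
  have lin: "linear \<sigma>"
    by (rule linearI) (simp_all add: \<sigma>_def inner_add_right algebra_simps add_divide_distrib)
  have inv: "\<sigma> (\<sigma> x) = x" for x
    using nu by (simp add: \<sigma>_def inner_diff_right algebra_simps flip: scaleR_add_left)
  have iso: "N (\<sigma> x) = N x" for x
  proof -
    define q where "q = x - ((n \<bullet> x) / (n \<bullet> u)) *\<^sub>R u"
    have "n \<bullet> q = 0" using nu by (simp add: q_def inner_diff_right)
    then have "N (((n \<bullet> x) / (n \<bullet> u)) *\<^sub>R u + q) = N (((n \<bullet> x) / (n \<bullet> u)) *\<^sub>R u - q)"
      by (intro reflection_symmetry_of_slice[OF n]) (auto intro: smooth)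
    moreover have "((n \<bullet> x) / (n \<bullet> u)) *\<^sub>R u - q = - \<sigma> x"
      by (simp add: q_def \<sigma>_def scaleR_2 flip: scaleR_scaleR times_divide_eq_right)
    ultimately show ?thesis by (simp add: q_def)
  qed
  have \<sigma>u: "\<sigma> u = - u" using nu by (simp add: \<sigma>_def scaleR_2)
  have orth: "dual_form q u = 0" if "n \<bullet> q = 0" for q
  proof -
    have "\<sigma> q = q" using that by (simp add: \<sigma>_def)
    then have "dual_form q (- u) = dual_form q u"
      using dual_form_invariant[OF lin iso inv, of q u] \<sigma>u by simp
    then show ?thesis by (simp add: dual_form_simps)
  qed
  have "u \<noteq> 0" using nu by auto
  then have Qu: "dual_form u u \<noteq> 0" using dual_form_pos[of u] by simp
  have "dual_form (x - ((n \<bullet> x) / (n \<bullet> u)) *\<^sub>R u) u = 0"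
    using nu by (intro orth) (simp add: inner_diff_right)
  then have "dual_form x u = (n \<bullet> x) / (n \<bullet> u) * dual_form u u"
    by (simp add: dual_form_simps)
  then have "reflect u x = \<sigma> x"
    using Qu by (simp add: reflect_def \<sigma>_def)
  with iso show ?thesis by simp
qed

text \<open>Smooth points are dense, and the reflected vector depends continuously on \<open>v\<close>.\<close>

lemma norm_reflect:
  assumes "v \<noteq> 0"
  shows "N (reflect v x) = N x"
proof (rule ccontr)
  define f where "f u = N (reflect u x) - N x" for u
  assume "\<not> ?thesis"
  then have fv: "f v \<noteq> 0" by (simp add: f_def)
  have bb: "bounded_bilinear dual_form"
    using dual_form_bilinear by (simp add: bilinear_conv_bounded_bilinear)
  have "isCont f v"
    unfolding f_def reflect_def using dual_form_pos[OF assms]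
    by (intro continuous_intros isCont_comp
        bounded_bilinear.continuous[OF bb]) auto
  then obtain d where d: "d > 0" "\<And>u. dist u v < d \<Longrightarrow> dist (f u) (f v) < \<bar>f v\<bar>"
    using fv unfolding continuous_at_eps_delta by (metis zero_less_abs_iff)
  obtain u n where u: "norm (u - v) < d" "n \<noteq> 0" "\<And>e. bj_orthogonal u e \<Longrightarrow> n \<bullet> e = 0"
    using smooth_point_near[OF assms d(1)] by metis
  have "f u = 0" using norm_reflect_at_smooth[OF u(2,3)] by (simp add: f_def)
  then show False using d(2)[of u] u(1) by (simp add: dist_norm)
qed

text \<open>Two vectors \<open>x\<close> and \<open>y\<close> of equal length for the form are exchanged by the reflection along \<open>x - y\<close>, so
\<open>N\<close> is constant on the spheres of the form; one vector \<open>w\<close> fixes the scaling factor \<open>k\<close>.\<close>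

theorem norm_from_inner_product:
  "\<exists>Q. inner_product_on_space Q \<and> (\<forall>x. N x = sqrt (Q x x))"
proof -
  have sphere: "N x = N y" if eq: "dual_form x x = dual_form y y" for x y
  proof (cases "x = y")
    case False
    define u where "u = x - y"
    have "dual_form u u \<noteq> 0" using dual_form_pos[of u] False by (simp add: u_def)
    moreover have "dual_form u u = 2 * dual_form x u"
      using eq dual_form_sym[of x y] by (simp add: u_def dual_form_simps)
    ultimately have "reflect u x = y" by (simp add: reflect_def) (simp add: u_def)
    then show ?thesis using norm_reflect[of u x] False by (simp add: u_def)
  qed simp
  define w :: "real^3" where "w = axis 1 1"
  have w: "w \<noteq> 0" by (simp add: w_def)
  define k where "k = (N w)\<^sup>2 / dual_form w w"
  have k: "k > 0" unfolding k_def using pos[OF w] dual_form_pos[OF w] by simp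
  define Q where "Q x y = k * dual_form x y" for x y
  have "inner_product_on_space Q"
    unfolding inner_product_on_space_def
  proof (intro conjI allI impI)
    have "linear (Q x)" "linear (\<lambda>y. Q y x)" for x
      by (rule linearI; simp add: Q_def dual_form_simps algebra_simps)+
    then show "bilinear Q" by (simp add: bilinear_def)
    show "Q x y = Q y x" for x y by (simp add: Q_def dual_form_sym)
    show "0 < Q x x" if "x \<noteq> 0" for x using k dual_form_pos[OF that] by (simp add: Q_def)
  qed
  moreover have "N x = sqrt (Q x x)" for x
  proof -
    have ge: "dual_form x x \<ge> 0" using dual_form_pos[of x] by (cases "x = 0") auto
    define s where "s = sqrt (dual_form x x / dual_form w w)"
    have s: "s \<ge> 0" "s * s = dual_form x x / dual_form w w"
      using ge dual_form_pos[OF w] by (simp_all add: s_def)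
    have "dual_form (s *\<^sub>R w) (s *\<^sub>R w) = dual_form x x"
      using s(2) dual_form_pos[OF w] by (simp add: dual_form_simps flip: mult.assoc)
    then have "N x = s * N w" using sphere[of "s *\<^sub>R w" x] s(1) by (simp add: scale)
    also have "\<dots> = sqrt (s * s * (N w)\<^sup>2)" using s(1) by (simp add: real_sqrt_mult)
    also have "\<dots> = sqrt (Q x x)" unfolding s(2) by (simp add: Q_def k_def)
    finally show ?thesis .
  qed
  ultimately show ?thesis by blast
qed

end

unbundle no cross3_syntax

section \<open>Contractible coverings and Hilbert norms\<close>

theorem theorem4:
  assumes "dim (UNIV :: 'a::banach set) = 3"
  shows "(\<forall>(V :: 'a set) \<B>. admissible_covering V \<B> \<longrightarrow> contractible_covering \<B>)
         \<longleftrightarrow> hilbert_norm TYPE('a)"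
proof
  assume contr: "\<forall>(V :: 'a set) \<B>. admissible_covering V \<B> \<longrightarrow> contractible_covering \<B>"
  obtain h :: "real^3 \<Rightarrow> 'a" and k where hk: "bounded_linear h" "bounded_linear k"
      "\<And>x. k (h x) = x" "\<And>y. h (k y) = y"
    using coordinates_of_dim_3[OF assms] by metis
  interpret h: bounded_linear h by (rule hk(1))
  interpret k: bounded_linear k by (rule hk(2))
  have nf: "norm_function (\<lambda>x. norm (h x))"
  proof
    show "norm (h (x + y)) \<le> norm (h x) + norm (h y)" for x y
      by (simp add: h.add norm_triangle_ineq)
    show "norm (h (c *\<^sub>R x)) = \<bar>c\<bar> * norm (h x)" for c x by (simp add: h.scaleR)
    show "0 < norm (h x)" if "x \<noteq> 0" for x using that hk(3)[of x] k.zero by auto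
  qed
  interpret plane_orthogonal_norm "\<lambda>x. norm (h x)"
  proof (intro plane_orthogonal_norm.intro norm_function_3.intro nf plane_orthogonal_norm_axioms.intro)
    fix n :: "real^3" assume n: "n \<noteq> 0"
    have "bounded_linear (\<lambda>y. n \<bullet> k y)"
      by (rule bounded_linear_compose[OF bounded_linear_inner_right hk(2)])
    moreover have "n \<bullet> k (h n) \<noteq> 0" using n by (simp add: hk(3))
    ultimately obtain e where e: "n \<bullet> k e \<noteq> 0"
        "\<And>f t. n \<bullet> k f = 0 \<Longrightarrow> norm f \<le> norm (f + t *\<^sub>R e)"
      using exists_common_bj_orthogonal[OF assms, of "\<lambda>y. n \<bullet> k y" "h n"] contr
      unfolding contractible_covering_def by blast
    have "norm (h f) \<le> norm (h (f + t *\<^sub>R k e))" if "n \<bullet> f = 0" for f t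
      using e(2)[of "h f" t] that by (simp add: h.add h.scaleR hk)
    then show "\<exists>e. n \<bullet> e \<noteq> 0 \<and> (\<forall>f. n \<bullet> f = 0 \<longrightarrow> norm_function.bj_orthogonal (\<lambda>x. norm (h x)) f e)"
      using e(1) unfolding norm_function.bj_orthogonal_def[OF nf] by blast
  qed
  obtain Q where Q: "inner_product_on_space Q" "\<And>x. norm (h x) = sqrt (Q x x)"
    using norm_from_inner_product by blast
  define ip where "ip x y = Q (k x) (k y)" for x y
  have "bilinear ip"
  proof -
    have "linear (Q x)" "linear (\<lambda>y. Q y x)" for x
      using Q(1) by (auto simp: inner_product_on_space_def bilinear_def)
    then have "linear (Q (k x) \<circ> k)" "linear ((\<lambda>y. Q y (k x)) \<circ> k)" for x
      using k.linear_axioms by (auto intro: linear_compose)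
    then show ?thesis by (simp add: bilinear_def ip_def o_def)
  qed
  moreover have "k x \<noteq> 0" if "x \<noteq> 0" for x using that hk(4) h.zero by metis
  ultimately have "inner_product_on_space ip"
    using Q(1) by (auto simp: inner_product_on_space_def ip_def)
  moreover have "norm x = sqrt (ip x x)" for x
    using Q(2)[of "k x"] by (simp add: ip_def hk(4))
  ultimately show "hilbert_norm TYPE('a)" unfolding hilbert_norm_def by blast
next
  assume "hilbert_norm TYPE('a)"
  then obtain ip :: "'a \<Rightarrow> 'a \<Rightarrow> real" where
      ip: "inner_product_on_space ip" "\<And>x. norm x = sqrt (ip x x)"
    unfolding hilbert_norm_def by blast
  interpret inner_product_norm ip
    using ip by unfold_locales (auto simp: inner_product_on_space_def)
  show "\<forall>(V :: 'a set) \<B>. admissible_covering V \<B> \<longrightarrow> contractible_covering \<B>"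
    unfolding contractible_covering_def using contractible_of_centres_in[OF assms] by blast
qed

end
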